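(* Let $n\ge 2$ be an integer. The monoid $M_n$ (defined by generators and relations in the context) is isomorphic, as a monoid, to the $n$-stranded virtual singular braid monoid $VSB_n$ (defined by generators and relations in the context).
   Context: $VSB_n$ is the monoid, with identity $1_n$, presented by generators $\sigma_i,\sigma_i^{-1},v_i,\tau_i$ ($1\le i\le n-1$) and relations (indices range over all values in $\{1,\dots,n-1\}$ satisfying the indicated condition): (1) $\sigma_i\sigma_i^{-1}=\sigma_i^{-1}\sigma_i=1_n$; (2) $v_i^2=1_n$; (3) $\sigma_i\sigma_j\sigma_i=\sigma_j\sigma_i\sigma_j$ for $|i-j|=1$; (4) $v_iv_jv_i=v_jv_iv_j$ for $|i-j|=1$; (5) $v_i\sigma_jv_i=v_j\sigma_iv_j$ for $|i-j|=1$; (6) $v_i\tau_jv_i=v_j\tau_iv_j$ for $|i-j|=1$; (7) $\sigma_i\sigma_j\tau_i=\tau_j\sigma_i\sigma_j$ for $|i-j|=1$; (8) $\sigma_i\tau_i=\tau_i\sigma_i$; (9) $g_ih_j=h_jg_i$ for $|i-j|>1$, where $g_i\in\{\sigma_i,\tau_i,v_i\}$ and $h_j\in\{\sigma_j,\tau_j,v_j\}$. $M_n$ is the monoid, with identity $1_n$, presented by generators $\mu_i,\mu_i^{-1},\gamma_i,v_i$ ($1\le i\le n-1$) and relations: (a) $v_i^2=1_n$ and $\mu_i\mu_i^{-1}=1_n=\mu_i^{-1}\mu_i$; (b) $v_iv_jv_i=v_jv_iv_j$ for $|i-j|=1$; (c) $v_i\mu_jv_i=v_j\mu_iv_j$ for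 $|i-j|=1$; (d) $v_i\gamma_jv_i=v_j\gamma_iv_j$ for $|i-j|=1$; (e) $\mu_j(v_j\mu_iv_j)\mu_i=\mu_i(v_j\mu_iv_j)\mu_j$ for $|i-j|=1$; (f) $\mu_j(v_j\mu_iv_j)\gamma_i=\gamma_i(v_j\mu_iv_j)\mu_j$ for $|i-j|=1$; (g) $\mu_iv_i\gamma_i=\gamma_iv_i\mu_i$; (h) $\alpha_i\beta_j=\beta_j\alpha_i$ for $|i-j|>1$, for all $\alpha_i\in\{\mu_i,\gamma_i,v_i\}$ and $\beta_j\in\{\mu_j,\gamma_j,v_j\}$. *)

theory Defs
  imports "HOL-Algebra.Group"
begin

text \<open>
  The congruence on the free monoid \<^term>\<open>lists A\<close> (words, with concatenation) generated by
  the pairs in \<^term>\<open>R\<close>. Formal inverses of generators are separate letters, tied to the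
  generators only by the relations.
\<close>

inductive_set pres_cong :: "'a set \<Rightarrow> ('a list \<times> 'a list) set \<Rightarrow> ('a list \<times> 'a list) set"
  for A :: "'a set" and R :: "('a list \<times> 'a list) set" where
  base: "(u, v) \<in> R \<Longrightarrow> u \<in> lists A \<Longrightarrow> v \<in> lists A \<Longrightarrow> (u, v) \<in> pres_cong A R"
| refl: "u \<in> lists A \<Longrightarrow> (u, u) \<in> pres_cong A R"
| sym: "(u, v) \<in> pres_cong A R \<Longrightarrow> (v, u) \<in> pres_cong A R"
| trans: "(u, v) \<in> pres_cong A R \<Longrightarrow> (v, w) \<in> pres_cong A R \<Longrightarrow> (u, w) \<in> pres_cong A R"
| mult: "(u, v) \<in> pres_cong A R \<Longrightarrow> (u', v') \<in> pres_cong A R \<Longrightarrow> (u @ u', v @ v') \<in> pres_cong A R"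

definition presented_monoid :: "'a set \<Rightarrow> ('a list \<times> 'a list) set \<Rightarrow> 'a list set monoid" where
  "presented_monoid A R =
    \<lparr>carrier = lists A // pres_cong A R,
     mult = (\<lambda>X Y. \<Union>x\<in>X. \<Union>y\<in>Y. pres_cong A R `` {x @ y}),
     one = pres_cong A R `` {[]}\<rparr>"

lemma pres_cong_in_lists:
  assumes "(u, v) \<in> pres_cong A R"
  shows "u \<in> lists A \<and> v \<in> lists A"
  using assms by induction auto

lemma equiv_pres_cong: "equiv (lists A) (pres_cong A R)"
proof (rule equivI)
  show "pres_cong A R \<subseteq> lists A \<times> lists A"
    using pres_cong_in_lists by fast
  show "refl_on (lists A) (pres_cong A R)"
    by (rule refl_onI) (rule pres_cong.refl)
  show "sym (pres_cong A R)"
    by (rule symI) (rule pres_cong.sym)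
  show "trans (pres_cong A R)"
    by (rule transI) (rule pres_cong.trans)
qed

lemma congruent2_pres_cong:
  "congruent2 (pres_cong A R) (pres_cong A R) (\<lambda>x y. pres_cong A R `` {x @ y})"
  by (auto simp: congruent2_def intro!: equiv_class_eq[OF equiv_pres_cong] pres_cong.mult)

lemma presented_monoid_mult_class:
  assumes "x \<in> lists A" "y \<in> lists A"
  shows "(pres_cong A R `` {x}) \<otimes>\<^bsub>presented_monoid A R\<^esub> (pres_cong A R `` {y})
    = pres_cong A R `` {x @ y}"
  using UN_equiv_class2[OF equiv_pres_cong equiv_pres_cong congruent2_pres_cong assms]
  by (simp add: presented_monoid_def)

lemma monoid_presented_monoid: "monoid (presented_monoid A R)"
proof -
  let ?M = "presented_monoid A R" and ?c = "\<lambda>x. pres_cong A R `` {x}"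
  have one: "\<one>\<^bsub>?M\<^esub> = ?c []"
    by (simp add: presented_monoid_def)
  have mem: "?c x \<in> carrier ?M" if "x \<in> lists A" for x
    using that by (simp add: presented_monoid_def quotientI del: in_lists_conv_set)
  have rep: "\<exists>x\<in>lists A. X = ?c x" if "X \<in> carrier ?M" for X
    using that by (auto simp: presented_monoid_def elim: quotientE)
  have nil: "[] \<in> lists A"
    by simp
  have app: "x @ y \<in> lists A" if "x \<in> lists A" "y \<in> lists A" for x y
    using that by simp
  note mult = presented_monoid_mult_class
  show ?thesis
  proof (rule monoidI)
    show "\<one>\<^bsub>?M\<^esub> \<in> carrier ?M"
      unfolding one by (rule mem[OF nil])
  next
    fix X Y assume "X \<in> carrier ?M" "Y \<in> carrier ?M"
    then obtain x y where "x \<in> lists A" "X = ?c x" "y \<in> lists A" "Y = ?c y"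
      using rep by meson
    then show "X \<otimes>\<^bsub>?M\<^esub> Y \<in> carrier ?M"
      by (simp only: mult app mem)
  next
    fix X Y Z assume "X \<in> carrier ?M" "Y \<in> carrier ?M" "Z \<in> carrier ?M"
    then obtain x y z where
      "x \<in> lists A" "X = ?c x" "y \<in> lists A" "Y = ?c y" "z \<in> lists A" "Z = ?c z"
      using rep by meson
    then show "X \<otimes>\<^bsub>?M\<^esub> Y \<otimes>\<^bsub>?M\<^esub> Z = X \<otimes>\<^bsub>?M\<^esub> (Y \<otimes>\<^bsub>?M\<^esub> Z)"
      by (simp only: mult app append_assoc)
  next
    fix X assume "X \<in> carrier ?M"
    then obtain x where "x \<in> lists A" "X = ?c x"
      using rep by meson
    then show "\<one>\<^bsub>?M\<^esub> \<otimes>\<^bsub>?M\<^esub> X = X" and "X \<otimes>\<^bsub>?M\<^esub> \<one>\<^bsub>?M\<^esub> = X"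
      by (simp_all only: one mult nil append_Nil append_Nil2)
  qed
qed

datatype vsb_gen = VSB_sigma nat | VSB_sigma_inv nat | VSB_v nat | VSB_tau nat

definition vsb_gens :: "nat \<Rightarrow> vsb_gen set" where
  "vsb_gens n = (\<Union>i\<in>{1..n-1}. {VSB_sigma i, VSB_sigma_inv i, VSB_v i, VSB_tau i})"

inductive_set vsb_rels :: "nat \<Rightarrow> (vsb_gen list \<times> vsb_gen list) set" for n :: nat where
  sigma_inv_right: "i \<in> {1..n-1} \<Longrightarrow> ([VSB_sigma i, VSB_sigma_inv i], []) \<in> vsb_rels n"
| sigma_inv_left: "i \<in> {1..n-1} \<Longrightarrow> ([VSB_sigma_inv i, VSB_sigma i], []) \<in> vsb_rels n"
| v_square: "i \<in> {1..n-1} \<Longrightarrow> ([VSB_v i, VSB_v i], []) \<in> vsb_rels n"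
| sigma_braid: "i \<in> {1..n-1} \<Longrightarrow> j \<in> {1..n-1} \<Longrightarrow> \<bar>int i - int j\<bar> = 1 \<Longrightarrow>
    ([VSB_sigma i, VSB_sigma j, VSB_sigma i], [VSB_sigma j, VSB_sigma i, VSB_sigma j]) \<in> vsb_rels n"
| v_braid: "i \<in> {1..n-1} \<Longrightarrow> j \<in> {1..n-1} \<Longrightarrow> \<bar>int i - int j\<bar> = 1 \<Longrightarrow>
    ([VSB_v i, VSB_v j, VSB_v i], [VSB_v j, VSB_v i, VSB_v j]) \<in> vsb_rels n"
| v_sigma_v: "i \<in> {1..n-1} \<Longrightarrow> j \<in> {1..n-1} \<Longrightarrow> \<bar>int i - int j\<bar> = 1 \<Longrightarrow>
    ([VSB_v i, VSB_sigma j, VSB_v i], [VSB_v j, VSB_sigma i, VSB_v j]) \<in> vsb_rels n"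
| v_tau_v: "i \<in> {1..n-1} \<Longrightarrow> j \<in> {1..n-1} \<Longrightarrow> \<bar>int i - int j\<bar> = 1 \<Longrightarrow>
    ([VSB_v i, VSB_tau j, VSB_v i], [VSB_v j, VSB_tau i, VSB_v j]) \<in> vsb_rels n"
| sigma_sigma_tau: "i \<in> {1..n-1} \<Longrightarrow> j \<in> {1..n-1} \<Longrightarrow> \<bar>int i - int j\<bar> = 1 \<Longrightarrow>
    ([VSB_sigma i, VSB_sigma j, VSB_tau i], [VSB_tau j, VSB_sigma i, VSB_sigma j]) \<in> vsb_rels n"
| sigma_tau: "i \<in> {1..n-1} \<Longrightarrow>
    ([VSB_sigma i, VSB_tau i], [VSB_tau i, VSB_sigma i]) \<in> vsb_rels n"
| far_comm: "i \<in> {1..n-1} \<Longrightarrow> j \<in> {1..n-1} \<Longrightarrow> \<bar>int i - int j\<bar> > 1 \<Longrightarrow>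
    g \<in> {VSB_sigma i, VSB_tau i, VSB_v i} \<Longrightarrow> h \<in> {VSB_sigma j, VSB_tau j, VSB_v j} \<Longrightarrow>
    ([g, h], [h, g]) \<in> vsb_rels n"

definition VSB :: "nat \<Rightarrow> vsb_gen list set monoid" where
  "VSB n = presented_monoid (vsb_gens n) (vsb_rels n)"

datatype m_gen = M_mu nat | M_mu_inv nat | M_gamma nat | M_v nat

definition m_gens :: "nat \<Rightarrow> m_gen set" where
  "m_gens n = (\<Union>i\<in>{1..n-1}. {M_mu i, M_mu_inv i, M_gamma i, M_v i})"

inductive_set m_rels :: "nat \<Rightarrow> (m_gen list \<times> m_gen list) set" for n :: nat where
  v_square: "i \<in> {1..n-1} \<Longrightarrow> ([M_v i, M_v i], []) \<in> m_rels n"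
| mu_inv_right: "i \<in> {1..n-1} \<Longrightarrow> ([M_mu i, M_mu_inv i], []) \<in> m_rels n"
| mu_inv_left: "i \<in> {1..n-1} \<Longrightarrow> ([M_mu_inv i, M_mu i], []) \<in> m_rels n"
| v_braid: "i \<in> {1..n-1} \<Longrightarrow> j \<in> {1..n-1} \<Longrightarrow> \<bar>int i - int j\<bar> = 1 \<Longrightarrow>
    ([M_v i, M_v j, M_v i], [M_v j, M_v i, M_v j]) \<in> m_rels n"
| v_mu_v: "i \<in> {1..n-1} \<Longrightarrow> j \<in> {1..n-1} \<Longrightarrow> \<bar>int i - int j\<bar> = 1 \<Longrightarrow>
    ([M_v i, M_mu j, M_v i], [M_v j, M_mu i, M_v j]) \<in> m_rels n"
| v_gamma_v: "i \<in> {1..n-1} \<Longrightarrow> j \<in> {1..n-1} \<Longrightarrow> \<bar>int i - int j\<bar> = 1 \<Longrightarrow>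
    ([M_v i, M_gamma j, M_v i], [M_v j, M_gamma i, M_v j]) \<in> m_rels n"
| mu_mu_mu: "i \<in> {1..n-1} \<Longrightarrow> j \<in> {1..n-1} \<Longrightarrow> \<bar>int i - int j\<bar> = 1 \<Longrightarrow>
    ([M_mu j, M_v j, M_mu i, M_v j, M_mu i], [M_mu i, M_v j, M_mu i, M_v j, M_mu j]) \<in> m_rels n"
| mu_mu_gamma: "i \<in> {1..n-1} \<Longrightarrow> j \<in> {1..n-1} \<Longrightarrow> \<bar>int i - int j\<bar> = 1 \<Longrightarrow>
    ([M_mu j, M_v j, M_mu i, M_v j, M_gamma i], [M_gamma i, M_v j, M_mu i, M_v j, M_mu j]) \<in> m_rels n"
| mu_v_gamma: "i \<in> {1..n-1} \<Longrightarrow>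
    ([M_mu i, M_v i, M_gamma i], [M_gamma i, M_v i, M_mu i]) \<in> m_rels n"
| far_comm: "i \<in> {1..n-1} \<Longrightarrow> j \<in> {1..n-1} \<Longrightarrow> \<bar>int i - int j\<bar> > 1 \<Longrightarrow>
    a \<in> {M_mu i, M_gamma i, M_v i} \<Longrightarrow> b \<in> {M_mu j, M_gamma j, M_v j} \<Longrightarrow>
    ([a, b], [b, a]) \<in> m_rels n"

definition M_monoid :: "nat \<Rightarrow> m_gen list set monoid" where
  "M_monoid n = presented_monoid (m_gens n) (m_rels n)"

end

theory Submission
  imports Defs
begin

text \<open>
  Multiplying each crossing by the virtual crossing on the same strands turns one presentation
  into the other: \<open>\<mu>\<^sub>i\<close> corresponds to \<open>\<sigma>\<^sub>i v\<^sub>i\<close> and \<open>\<gamma>\<^sub>i\<close> to \<open>\<tau>\<^sub>i v\<^sub>i\<close>, while the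
  \<open>v\<^sub>i\<close> are kept. As \<open>v\<^sub>i\<close> is an involution, the inverse substitution has the same form,
  \<open>\<sigma>\<^sub>i = \<mu>\<^sub>i v\<^sub>i\<close> and \<open>\<tau>\<^sub>i = \<gamma>\<^sub>i v\<^sub>i\<close>, so only the relations have to be compared.

  The comparison takes place in an arbitrary monoid, where it becomes symmetric. For adjacent
  \<open>i\<close> and \<open>j\<close>, the relation \<open>v\<^sub>i x\<^sub>j v\<^sub>i = v\<^sub>j x\<^sub>i v\<^sub>j\<close> survives the replacement of \<open>x\<close>
  by \<open>x v\<close> (\<open>swapped_twist\<close>), and it lets \<open>x\<close> slide through a product of two virtual
  crossings, changing its index. Collecting all virtual crossings at the right end of the words
  in the relations of \<open>M\<^sub>n\<close> with three real crossings leaves \<open>v\<^sub>i v\<^sub>j v\<^sub>i\<close> on both sides,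
  and cancelling it leaves the three-letter relations of \<open>VSB\<^sub>n\<close>. Since this element is
  invertible, the two families of relations are equivalent (\<open>triangle_relation_iff\<close>); the relation
  between \<open>\<sigma>\<^sub>i\<close> and \<open>\<tau>\<^sub>i\<close> is treated in the same way (\<open>commute_twist_iff\<close>).

  Hence the interpretations of the two presentations in any monoid are in mutually inverse
  correspondence (\<open>represents_twist_vsb\<close>, \<open>represents_twist_m\<close>), and this correspondence commutes
  with homomorphisms. By the universal property the two presented monoids are isomorphic: twisting
  the tautological interpretation of each one gives a homomorphism from the other, and
  both composites fix the generators.
\<close>

section \<open>The universal property of a presented monoid\<close>

definition word_eval :: "('b, 'c) monoid_scheme \<Rightarrow> ('a \<Rightarrow> 'b) \<Rightarrow> 'a list \<Rightarrow> 'b" where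
  "word_eval G f w = foldr (\<lambda>a x. f a \<otimes>\<^bsub>G\<^esub> x) w \<one>\<^bsub>G\<^esub>"

lemma word_eval_Nil [simp]: "word_eval G f [] = \<one>\<^bsub>G\<^esub>"
  and word_eval_Cons [simp]: "word_eval G f (a # w) = f a \<otimes>\<^bsub>G\<^esub> word_eval G f w"
  by (simp_all add: word_eval_def)

definition represents ::
    "('b, 'c) monoid_scheme \<Rightarrow> 'a set \<Rightarrow> ('a list \<times> 'a list) set \<Rightarrow> ('a \<Rightarrow> 'b) \<Rightarrow> bool" where
  "represents G A R f \<longleftrightarrow>
    f \<in> A \<rightarrow> carrier G \<and> (\<forall>(u, v) \<in> R. word_eval G f u = word_eval G f v)"

lemma represents_closed: "represents G A R f \<Longrightarrow> a \<in> A \<Longrightarrow> f a \<in> carrier G"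
  and represents_eq: "represents G A R f \<Longrightarrow> (u, v) \<in> R \<Longrightarrow> word_eval G f u = word_eval G f v"
  and represents_funcset: "represents G A R f \<Longrightarrow> f \<in> A \<rightarrow> carrier G"
  unfolding represents_def by fast+

definition word_class :: "'a set \<Rightarrow> ('a list \<times> 'a list) set \<Rightarrow> 'a list \<Rightarrow> 'a list set" where
  "word_class A R w = pres_cong A R `` {w}"

text \<open>
  On a congruence class all words have the same value, so the image below is a singleton
  whenever \<^term>\<open>f\<close> satisfies the relations.
\<close>

definition induced_map ::
    "('b, 'c) monoid_scheme \<Rightarrow> ('a \<Rightarrow> 'b) \<Rightarrow> 'a list set \<Rightarrow> 'b" where
  "induced_map G f X = the_elem (word_eval G f ` X)"

lemma word_class_closed:
  "w \<in> lists A \<Longrightarrow> word_class A R w \<in> carrier (presented_monoid A R)"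
  by (simp add: word_class_def presented_monoid_def quotientI del: in_lists_conv_set)

lemma carrier_presented_monoidE:
  assumes "X \<in> carrier (presented_monoid A R)"
  obtains w where "w \<in> lists A" "X = word_class A R w"
  using assms unfolding word_class_def presented_monoid_def
  by (auto simp del: in_lists_conv_set elim!: quotientE)

lemma word_class_mult:
  "x \<in> lists A \<Longrightarrow> y \<in> lists A \<Longrightarrow>
    word_class A R x \<otimes>\<^bsub>presented_monoid A R\<^esub> word_class A R y = word_class A R (x @ y)"
  unfolding word_class_def by (rule presented_monoid_mult_class)

lemma word_class_Nil: "word_class A R [] = \<one>\<^bsub>presented_monoid A R\<^esub>"
  by (simp add: word_class_def presented_monoid_def)

lemma word_eval_word_class:
  assumes "w \<in> lists A"
  shows "word_eval (presented_monoid A R) (\<lambda>a. word_class A R [a]) w = word_class A R w"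
  using assms
proof (induction w rule: lists.induct)
  case Nil
  show ?case by (simp add: word_class_Nil)
next
  case (Cons a w)
  then have "[a] \<in> lists A" "w \<in> lists A" by auto
  from word_class_mult[OF this] show ?case by (simp add: Cons.IH)
qed

text \<open>The tautological interpretation, by which each generator stands for its own class.\<close>

lemma represents_word_class:
  assumes "R \<subseteq> lists A \<times> lists A"
  shows "represents (presented_monoid A R) A R (\<lambda>a. word_class A R [a])"
  unfolding represents_def
proof (intro conjI ballI funcsetI, goal_cases)
  case (1 a)
  then show ?case by (intro word_class_closed) auto
next
  case (2 r)
  obtain u v where r: "r = (u, v)" by (cases r)
  have uv: "u \<in> lists A" "v \<in> lists A" using 2 r assms by blast+
  have "(u, v) \<in> pres_cong A R"
    using 2 uv unfolding r by (intro pres_cong.base)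
  then have "word_class A R u = word_class A R v"
    unfolding word_class_def by (rule equiv_class_eq[OF equiv_pres_cong])
  then show ?case by (simp add: r word_eval_word_class uv del: in_lists_conv_set)
qed

context monoid
begin

lemma word_eval_closed:
  assumes f: "f \<in> A \<rightarrow> carrier G" and w: "w \<in> lists A"
  shows "word_eval G f w \<in> carrier G"
  using w
proof (induction w rule: lists.induct)
  case (Cons a w)
  then show ?case using funcset_mem[OF f] by simp
qed simp

lemma word_eval_append:
  assumes "f \<in> A \<rightarrow> carrier G" "u \<in> lists A" "v \<in> lists A"
  shows "word_eval G f (u @ v) = word_eval G f u \<otimes> word_eval G f v"
  using assms(2)
proof (induction u rule: lists.induct)
  case Nil
  show ?case using word_eval_closed[OF assms(1,3)] by simp
next
  case (Cons a u)
  have "f a \<in> carrier G" using Cons assms(1) by auto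
  then show ?case
    using Cons word_eval_closed[OF assms(1)] assms(3)
    by (simp add: m_assoc del: in_lists_conv_set)
qed

text \<open>
  The pairs of words with equal value form a congruence, and it contains the relations.
\<close>

lemma word_eval_pres_cong:
  assumes f: "represents G A R f" and "(u, v) \<in> pres_cong A R"
  shows "word_eval G f u = word_eval G f v"
  using assms(2)
proof induction
  case (base u v)
  then show ?case using represents_eq[OF f] by simp
next
  case (mult u v u' v')
  have "f \<in> A \<rightarrow> carrier G" using f by (rule represents_funcset)
  then show ?case
    using mult.IH pres_cong_in_lists[OF mult.hyps(1)] pres_cong_in_lists[OF mult.hyps(2)]
    by (simp add: word_eval_append del: in_lists_conv_set)
qed auto

lemma induced_map_word_class:
  assumes "represents G A R f" "w \<in> lists A"
  shows "induced_map G f (word_class A R w) = word_eval G f w"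
proof -
  have "w \<in> word_class A R w"
    unfolding word_class_def using assms(2) by (simp add: pres_cong.refl del: in_lists_conv_set)
  moreover have "word_eval G f x = word_eval G f w" if "x \<in> word_class A R w" for x
    using that unfolding word_class_def
    by (intro word_eval_pres_cong[OF assms(1), symmetric]) simp
  ultimately have "word_eval G f ` word_class A R w = {word_eval G f w}"
    by blast
  then show ?thesis by (simp add: induced_map_def)
qed

lemma induced_map_hom:
  assumes f: "represents G A R f"
  shows "induced_map G f \<in> hom (presented_monoid A R) G"
proof (rule homI)
  have fA: "f \<in> A \<rightarrow> carrier G" using f by (rule represents_funcset)
  note ev = induced_map_word_class[OF f]
  fix X assume "X \<in> carrier (presented_monoid A R)"
  then obtain x where x: "x \<in> lists A" "X = word_class A R x"
    by (rule carrier_presented_monoidE)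
  then show "induced_map G f X \<in> carrier G"
    unfolding x(2) ev[OF x(1)] by (intro word_eval_closed[OF fA])
  fix Y assume "Y \<in> carrier (presented_monoid A R)"
  then obtain y where y: "y \<in> lists A" "Y = word_class A R y"
    by (rule carrier_presented_monoidE)
  have "x @ y \<in> lists A" using x y by simp
  then show "induced_map G f (X \<otimes>\<^bsub>presented_monoid A R\<^esub> Y)
      = induced_map G f X \<otimes> induced_map G f Y"
    unfolding x(2) y(2) word_class_mult[OF x(1) y(1)] ev[OF x(1)] ev[OF y(1)] ev[OF \<open>x @ y \<in> lists A\<close>]
    by (intro word_eval_append[OF fA x(1) y(1)])
qed

lemma induced_map_generator:
  assumes "represents G A R f" "a \<in> A"
  shows "induced_map G f (word_class A R [a]) = f a"
proof -
  have "f a \<in> carrier G" by (rule represents_closed[OF assms])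
  then show ?thesis using induced_map_word_class[OF assms(1), of "[a]"] assms(2) by simp
qed

lemma induced_map_one:
  assumes "represents G A R f"
  shows "induced_map G f \<one>\<^bsub>presented_monoid A R\<^esub> = \<one>"
  using induced_map_word_class[OF assms lists.Nil] unfolding word_class_Nil word_eval_Nil .

end

text \<open>
  The uniqueness half of the universal property, in the only form needed to recognise that two
  homomorphisms are inverse to each other.
\<close>

lemma presented_monoid_endomorphism_id:
  assumes h: "h \<in> hom (presented_monoid A R) (presented_monoid A R)"
    and one: "h \<one>\<^bsub>presented_monoid A R\<^esub> = \<one>\<^bsub>presented_monoid A R\<^esub>"
    and gen: "\<And>a. a \<in> A \<Longrightarrow> h (word_class A R [a]) = word_class A R [a]"
    and X: "X \<in> carrier (presented_monoid A R)"
  shows "h X = X"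
proof -
  obtain w where w: "w \<in> lists A" and Xw: "X = word_class A R w"
    using X by (rule carrier_presented_monoidE)
  from w have "h (word_class A R w) = word_class A R w"
  proof (induction w rule: lists.induct)
    case Nil
    show ?case by (simp add: word_class_Nil one)
  next
    case (Cons a w)
    have a: "[a] \<in> lists A" using Cons by simp
    have "h (word_class A R [a] \<otimes>\<^bsub>presented_monoid A R\<^esub> word_class A R w)
        = h (word_class A R [a]) \<otimes>\<^bsub>presented_monoid A R\<^esub> h (word_class A R w)"
      by (intro hom_mult[OF h] word_class_closed a Cons)
    then show ?case
      using word_class_mult[OF a Cons.hyps(2), of R] Cons.IH gen[OF Cons.hyps(1)] by simp
  qed
  then show ?thesis by (simp add: Xw)
qed

lemma presented_monoid_iso:
  assumes f: "represents (presented_monoid B S) A R f"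
    and g: "represents (presented_monoid A R) B S g"
    and gf: "\<And>a. a \<in> A \<Longrightarrow> induced_map (presented_monoid A R) g (f a) = word_class A R [a]"
    and fg: "\<And>b. b \<in> B \<Longrightarrow> induced_map (presented_monoid B S) f (g b) = word_class B S [b]"
  shows "induced_map (presented_monoid B S) f \<in> iso (presented_monoid A R) (presented_monoid B S)"
proof -
  let ?P = "presented_monoid A R" and ?Q = "presented_monoid B S"
  let ?F = "induced_map ?Q f" and ?G = "induced_map ?P g"
  interpret P: monoid ?P by (rule monoid_presented_monoid)
  interpret Q: monoid ?Q by (rule monoid_presented_monoid)
  note F = Q.induced_map_hom[OF f] Q.induced_map_one[OF f] Q.induced_map_generator[OF f]
  note G = P.induced_map_hom[OF g] P.induced_map_one[OF g] P.induced_map_generator[OF g]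
  have GF: "?G (?F X) = X" if "X \<in> carrier ?P" for X
    using presented_monoid_endomorphism_id[of "?G \<circ> ?F", OF hom_compose[OF F(1) G(1)] _ _ that]
    by (simp add: F G gf)
  have FG: "?F (?G Y) = Y" if "Y \<in> carrier ?Q" for Y
    using presented_monoid_endomorphism_id[of "?F \<circ> ?G", OF hom_compose[OF G(1) F(1)] _ _ that]
    by (simp add: F G fg)
  have "bij_betw ?F (carrier ?P) (carrier ?Q)"
    using GF FG hom_in_carrier[OF F(1)] hom_in_carrier[OF G(1)]
    by (intro bij_betw_byWitness[where f' = ?G]) auto
  with F(1) show ?thesis by (simp add: iso_def)
qed

section \<open>Twisting by involutions that satisfy the braid relation\<close>

locale braided_involutions = monoid G for G (structure) +
  fixes v w
  assumes v_closed [simp]: "v \<in> carrier G" and w_closed [simp]: "w \<in> carrier G"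
    and vv [simp]: "v \<otimes> v = \<one>" and ww [simp]: "w \<otimes> w = \<one>"
    and braid: "v \<otimes> (w \<otimes> v) = w \<otimes> (v \<otimes> w)"
begin

lemma v_cancel [simp]: "z \<in> carrier G \<Longrightarrow> v \<otimes> (v \<otimes> z) = z"
  and w_cancel [simp]: "z \<in> carrier G \<Longrightarrow> w \<otimes> (w \<otimes> z) = z"
  by (simp_all flip: m_assoc)

text \<open>
  With \<open>v = v\<^sub>i\<close> and \<open>w = v\<^sub>j\<close>, this is the relation that both presentations impose on the pairs
  \<open>(x\<^sub>i, x\<^sub>j)\<close> of non-virtual crossings on adjacent strands.
\<close>

definition swapped :: "'a \<Rightarrow> 'a \<Rightarrow> bool" where
  "swapped x y \<longleftrightarrow> x \<in> carrier G \<and> y \<in> carrier G \<and> v \<otimes> (y \<otimes> v) = w \<otimes> (x \<otimes> w)"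

lemma swapped_closed: "swapped x y \<Longrightarrow> x \<in> carrier G" "swapped x y \<Longrightarrow> y \<in> carrier G"
  by (auto simp: swapped_def)

text \<open>
  A crossing passes through two consecutive virtual crossings at the cost of a change of index.
  Multiplying \<open>v y v = w x w\<close> by \<open>v\<close> on the left and \<open>w\<close> on the right gives one direction,
  interchanging the roles of \<open>v\<close> and \<open>w\<close> the other. The trailing factor \<open>z\<close> makes the rules
  applicable inside products associated to the right.
\<close>

lemma slide_up:
  assumes "swapped x y" "z \<in> carrier G"
  shows "v \<otimes> (w \<otimes> (x \<otimes> z)) = y \<otimes> (v \<otimes> (w \<otimes> z))"
proof -
  note [simp] = swapped_closed[OF assms(1)] assms(2)
  have "v \<otimes> ((w \<otimes> (x \<otimes> w)) \<otimes> (w \<otimes> z)) = v \<otimes> ((v \<otimes> (y \<otimes> v)) \<otimes> (w \<otimes> z))"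
    using assms by (simp add: swapped_def)
  then show ?thesis by (simp add: m_assoc)
qed

lemma slide_down:
  assumes "swapped x y" "z \<in> carrier G"
  shows "w \<otimes> (v \<otimes> (y \<otimes> z)) = x \<otimes> (w \<otimes> (v \<otimes> z))"
proof -
  note [simp] = swapped_closed[OF assms(1)] assms(2)
  have "w \<otimes> ((v \<otimes> (y \<otimes> v)) \<otimes> (v \<otimes> z)) = w \<otimes> ((w \<otimes> (x \<otimes> w)) \<otimes> (v \<otimes> z))"
    using assms by (simp add: swapped_def)
  then show ?thesis by (simp add: m_assoc)
qed

lemma swapped_twist:
  assumes xy: "swapped x y"
  shows "swapped (x \<otimes> v) (y \<otimes> w)"
proof -
  note [simp] = swapped_closed[OF xy]
  \<comment> \<open>Inserting \<open>v v\<close> after \<open>y\<close> exposes both \<open>v y v\<close> and the braid word \<open>v w v\<close>.\<close>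
  have "v \<otimes> (y \<otimes> (w \<otimes> v)) = (v \<otimes> (y \<otimes> v)) \<otimes> (v \<otimes> (w \<otimes> v))"
    by (simp add: m_assoc)
  also have "\<dots> = (w \<otimes> (x \<otimes> w)) \<otimes> (w \<otimes> (v \<otimes> w))"
    using xy by (simp add: swapped_def braid)
  also have "\<dots> = w \<otimes> (x \<otimes> (v \<otimes> w))"
    by (simp add: m_assoc)
  finally show ?thesis using xy by (simp add: swapped_def m_assoc)
qed

text \<open>
  With \<open>a = \<sigma>\<close> and \<open>b \<in> {\<sigma>, \<tau>}\<close>, the left-hand equation is the relation of \<open>M\<^sub>n\<close> between three
  non-virtual crossings, and the right-hand one is its counterpart in \<open>VSB\<^sub>n\<close>. Sliding every \<open>v\<close> and
  \<open>w\<close> to the right multiplies the two sides of the right-hand equation by the same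
  invertible element \<open>v w v\<close>. For the passage from \<open>M\<^sub>n\<close> to \<open>VSB\<^sub>n\<close> the lemma is applied to
  \<open>a = \<mu> v\<close>, so that \<open>a v\<close> collapses to \<open>\<mu>\<close>.
\<close>

lemma triangle_relation_iff:
  assumes a: "swapped a a'" and b: "swapped b b'"
  shows "(a' \<otimes> w) \<otimes> (w \<otimes> ((a \<otimes> v) \<otimes> (w \<otimes> (b \<otimes> v))))
       = (b \<otimes> v) \<otimes> (w \<otimes> ((a \<otimes> v) \<otimes> (w \<otimes> (a' \<otimes> w))))
    \<longleftrightarrow> a' \<otimes> (a \<otimes> b') = b \<otimes> (a' \<otimes> a)" (is "?l = ?r \<longleftrightarrow> _")
proof -
  note [simp] = swapped_closed[OF a] swapped_closed[OF b]
  let ?d = "v \<otimes> (w \<otimes> v)"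
  have l: "?l = (a' \<otimes> (a \<otimes> b')) \<otimes> ?d"
    using slide_up[OF b, of v] by (simp add: m_assoc)
  have "?r = b \<otimes> (a' \<otimes> (v \<otimes> (w \<otimes> (v \<otimes> (w \<otimes> (a' \<otimes> w))))))"
    using slide_up[OF a, of "v \<otimes> (w \<otimes> (a' \<otimes> w))"] by (simp add: m_assoc)
  also have "v \<otimes> (w \<otimes> (v \<otimes> (w \<otimes> (a' \<otimes> w)))) = (v \<otimes> (w \<otimes> v)) \<otimes> (w \<otimes> (a' \<otimes> w))"
    by (simp add: m_assoc)
  also have "\<dots> = w \<otimes> (v \<otimes> (a' \<otimes> w))"
    by (simp add: braid m_assoc)
  also have "\<dots> = a \<otimes> ?d"
    using slide_down[OF a, of w] by (simp add: braid)
  finally have r: "?r = (b \<otimes> (a' \<otimes> a)) \<otimes> ?d"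
    by (simp add: m_assoc)
  have d: "?d \<otimes> ?d = \<one>"
    by (simp add: m_assoc)
  have cancel: "x = y" if "x \<otimes> ?d = y \<otimes> ?d" "x \<in> carrier G" "y \<in> carrier G" for x y
  proof -
    have "x \<otimes> (?d \<otimes> ?d) = y \<otimes> (?d \<otimes> ?d)"
      using that by (metis m_assoc m_closed v_closed w_closed)
    then show ?thesis using that by (simp only: d r_one)
  qed
  show ?thesis
    unfolding l r using cancel[of "a' \<otimes> (a \<otimes> b')" "b \<otimes> (a' \<otimes> a)"] by auto
qed

end

context monoid
begin

lemma commute_twist_iff:
  assumes "v \<in> carrier G" "v \<otimes> v = \<one>" "a \<in> carrier G" "b \<in> carrier G"
  shows "(a \<otimes> v) \<otimes> (v \<otimes> (b \<otimes> v)) = (b \<otimes> v) \<otimes> (v \<otimes> (a \<otimes> v)) \<longleftrightarrow> a \<otimes> b = b \<otimes> a"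
proof -
  have [simp]: "v \<otimes> (v \<otimes> z) = z" if "z \<in> carrier G" for z
    using assms that by (simp flip: m_assoc)
  have "x = y" if "x \<otimes> v = y \<otimes> v" "x \<in> carrier G" "y \<in> carrier G" for x y
    using that assms by (metis m_assoc r_one)
  from this[of "a \<otimes> b" "b \<otimes> a"] show ?thesis
    using assms by (simp add: m_assoc) (metis m_assoc)
qed

lemma commute_mult:
  assumes "x \<otimes> y = y \<otimes> x" "x \<otimes> z = z \<otimes> x" "x \<in> carrier G" "y \<in> carrier G" "z \<in> carrier G"
  shows "x \<otimes> (y \<otimes> z) = (y \<otimes> z) \<otimes> x"
  using assms by (metis m_assoc)

text \<open>
  For distant indices every letter of one side commutes with every letter of the other, hence so
  do the products that replace the letters.
\<close>

lemma commute_twisted: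
  assumes comm: "\<And>x y. x \<in> {a, b, v} \<Longrightarrow> y \<in> {c, d, w} \<Longrightarrow> x \<otimes> y = y \<otimes> x"
    and cl: "{a, b, v, c, d, w} \<subseteq> carrier G"
    and x: "x \<in> {a \<otimes> v, b \<otimes> v, v}" and y: "y \<in> {c \<otimes> w, d \<otimes> w, w}"
  shows "x \<otimes> y = y \<otimes> x"
proof -
  have 1: "z \<otimes> y = y \<otimes> z" if "z \<in> {a, b, v}" for z
    using y that cl comm[OF that] by (auto intro!: commute_mult)
  have "y \<in> carrier G" using y cl by auto
  then have "y \<otimes> x = x \<otimes> y"
    using x cl 1 by (auto intro!: commute_mult simp: 1[symmetric])
  then show ?thesis ..
qed

lemma inverse_twist:
  assumes "v \<in> carrier G" "v \<otimes> v = \<one>" "a \<in> carrier G" "a' \<in> carrier G"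
    and "a \<otimes> a' = \<one>" "a' \<otimes> a = \<one>"
  shows "(a \<otimes> v) \<otimes> (v \<otimes> a') = \<one>" "(v \<otimes> a') \<otimes> (a \<otimes> v) = \<one>"
  using assms by (metis m_assoc m_closed r_one l_one)+

end

section \<open>Representations of the two presentations in a monoid\<close>

text \<open>
  A family indexed by the generators of one presentation is turned into one for the other. The formal
  inverse carries the virtual crossing on the left because inversion reverses the product.
\<close>

fun twist_vsb :: "('b, 'c) monoid_scheme \<Rightarrow> (vsb_gen \<Rightarrow> 'b) \<Rightarrow> m_gen \<Rightarrow> 'b" where
  "twist_vsb G f (M_mu i) = f (VSB_sigma i) \<otimes>\<^bsub>G\<^esub> f (VSB_v i)"
| "twist_vsb G f (M_mu_inv i) = f (VSB_v i) \<otimes>\<^bsub>G\<^esub> f (VSB_sigma_inv i)"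
| "twist_vsb G f (M_gamma i) = f (VSB_tau i) \<otimes>\<^bsub>G\<^esub> f (VSB_v i)"
| "twist_vsb G f (M_v i) = f (VSB_v i)"

fun twist_m :: "('b, 'c) monoid_scheme \<Rightarrow> (m_gen \<Rightarrow> 'b) \<Rightarrow> vsb_gen \<Rightarrow> 'b" where
  "twist_m G f (VSB_sigma i) = f (M_mu i) \<otimes>\<^bsub>G\<^esub> f (M_v i)"
| "twist_m G f (VSB_sigma_inv i) = f (M_v i) \<otimes>\<^bsub>G\<^esub> f (M_mu_inv i)"
| "twist_m G f (VSB_tau i) = f (M_gamma i) \<otimes>\<^bsub>G\<^esub> f (M_v i)"
| "twist_m G f (VSB_v i) = f (M_v i)"

lemma vsb_gens_iff [simp]:
  "VSB_sigma i \<in> vsb_gens n \<longleftrightarrow> i \<in> {1..n-1}"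
  "VSB_sigma_inv i \<in> vsb_gens n \<longleftrightarrow> i \<in> {1..n-1}"
  "VSB_v i \<in> vsb_gens n \<longleftrightarrow> i \<in> {1..n-1}"
  "VSB_tau i \<in> vsb_gens n \<longleftrightarrow> i \<in> {1..n-1}"
  by (auto simp: vsb_gens_def)

lemma m_gens_iff [simp]:
  "M_mu i \<in> m_gens n \<longleftrightarrow> i \<in> {1..n-1}"
  "M_mu_inv i \<in> m_gens n \<longleftrightarrow> i \<in> {1..n-1}"
  "M_v i \<in> m_gens n \<longleftrightarrow> i \<in> {1..n-1}"
  "M_gamma i \<in> m_gens n \<longleftrightarrow> i \<in> {1..n-1}"
  by (auto simp: m_gens_def)

lemma vsb_rels_words: "vsb_rels n \<subseteq> lists (vsb_gens n) \<times> lists (vsb_gens n)"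
proof (rule subrelI)
  fix u v assume "(u, v) \<in> vsb_rels n"
  then show "(u, v) \<in> lists (vsb_gens n) \<times> lists (vsb_gens n)"
    by cases auto
qed

lemma m_rels_words: "m_rels n \<subseteq> lists (m_gens n) \<times> lists (m_gens n)"
proof (rule subrelI)
  fix u v assume "(u, v) \<in> m_rels n"
  then show "(u, v) \<in> lists (m_gens n) \<times> lists (m_gens n)"
    by cases auto
qed

context monoid
begin

lemma represents_twist_vsb:
  assumes f: "represents G (vsb_gens n) (vsb_rels n) f"
  shows "represents G (m_gens n) (m_rels n) (twist_vsb G f)"
proof -
  have cl [simp]: "f (VSB_sigma i) \<in> carrier G" "f (VSB_sigma_inv i) \<in> carrier G"
      "f (VSB_tau i) \<in> carrier G" "f (VSB_v i) \<in> carrier G" if "i \<in> {1..n-1}" for i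
    using that by (auto intro: represents_closed[OF f])
  have rel: "word_eval G f u = word_eval G f v" if "(u, v) \<in> vsb_rels n" for u v
    using f that by (rule represents_eq)
  have square: "f (VSB_v i) \<otimes> f (VSB_v i) = \<one>" if "i \<in> {1..n-1}" for i
    using rel[OF vsb_rels.v_square[OF that]] cl[OF that] by simp
  have braided: "braided_involutions G (f (VSB_v i)) (f (VSB_v j))"
    if "i \<in> {1..n-1}" "j \<in> {1..n-1}" "\<bar>int i - int j\<bar> = 1" for i j
    using rel[OF vsb_rels.v_braid[OF that]] cl[OF that(1)] cl[OF that(2)] square that(1,2)
    by unfold_locales auto
  have swap_sigma: "braided_involutions.swapped G (f (VSB_v i)) (f (VSB_v j))
        (f (VSB_sigma i)) (f (VSB_sigma j))"
    and swap_tau: "braided_involutions.swapped G (f (VSB_v i)) (f (VSB_v j))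
        (f (VSB_tau i)) (f (VSB_tau j))"
    if "i \<in> {1..n-1}" "j \<in> {1..n-1}" "\<bar>int i - int j\<bar> = 1" for i j
    using rel[OF vsb_rels.v_sigma_v[OF that]] rel[OF vsb_rels.v_tau_v[OF that]]
      cl[OF that(1)] cl[OF that(2)] braided[OF that]
    by (simp_all add: braided_involutions.swapped_def)
  show ?thesis
    unfolding represents_def
  proof (intro conjI ballI, goal_cases)
    case 1
    show ?case by (auto simp: m_gens_def)
  next
    case (2 r)
    then obtain u v where r: "r = (u, v)" "(u, v) \<in> m_rels n" by (cases r) auto
    from r(2) have "word_eval G (twist_vsb G f) u = word_eval G (twist_vsb G f) v"
    proof cases
      case (v_square i)
      then show ?thesis by (simp add: square)
    next
      case (mu_inv_right i)
      then show ?thesis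
        using rel[OF vsb_rels.sigma_inv_right[of i]] rel[OF vsb_rels.sigma_inv_left[of i]]
        by (simp add: inverse_twist square)
    next
      case (mu_inv_left i)
      then show ?thesis
        using rel[OF vsb_rels.sigma_inv_right[of i]] rel[OF vsb_rels.sigma_inv_left[of i]]
        by (simp add: inverse_twist square)
    next
      case (v_braid i j)
      then show ?thesis using rel[OF vsb_rels.v_braid[of i n j]] by simp
    next
      case (v_mu_v i j)
      interpret braided_involutions G "f (VSB_v i)" "f (VSB_v j)"
        using braided v_mu_v by simp
      show ?thesis
        using swapped_twist[OF swap_sigma] v_mu_v by (simp add: swapped_def)
    next
      case (v_gamma_v i j)
      interpret braided_involutions G "f (VSB_v i)" "f (VSB_v j)"
        using braided v_gamma_v by simp
      show ?thesis
        using swapped_twist[OF swap_tau] v_gamma_v by (simp add: swapped_def)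
    next
      case (mu_mu_mu i j)
      interpret braided_involutions G "f (VSB_v i)" "f (VSB_v j)"
        using braided mu_mu_mu by simp
      show ?thesis
        using triangle_relation_iff[OF swap_sigma swap_sigma] mu_mu_mu
          rel[OF vsb_rels.sigma_braid[of i n j]] by simp
    next
      \<comment> \<open>Here the roles of \<open>i\<close> and \<open>j\<close> in the relation of \<open>VSB\<^sub>n\<close> are interchanged.\<close>
      case (mu_mu_gamma i j)
      interpret braided_involutions G "f (VSB_v i)" "f (VSB_v j)"
        using braided mu_mu_gamma by simp
      show ?thesis
        using triangle_relation_iff[OF swap_sigma swap_tau] mu_mu_gamma
          rel[OF vsb_rels.sigma_sigma_tau[of j n i]] by simp
    next
      case (mu_v_gamma i)
      then show ?thesis
        using rel[OF vsb_rels.sigma_tau[of i n]]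
        by (simp add: commute_twist_iff square)
    next
      case (far_comm i j a b)
      let ?a = "twist_vsb G f a" and ?b = "twist_vsb G f b"
      have "x \<otimes> y = y \<otimes> x"
        if xy: "x \<in> {f (VSB_sigma i), f (VSB_tau i), f (VSB_v i)}"
          "y \<in> {f (VSB_sigma j), f (VSB_tau j), f (VSB_v j)}" for x y
      proof -
        obtain g h where g: "g \<in> {VSB_sigma i, VSB_tau i, VSB_v i}" "x = f g"
          and h: "h \<in> {VSB_sigma j, VSB_tau j, VSB_v j}" "y = f h"
          using xy by blast
        have "f g \<in> carrier G" "f h \<in> carrier G"
          using g(1) h(1) far_comm(3,4) by auto
        then show ?thesis
          using rel[OF vsb_rels.far_comm[OF far_comm(3-5) g(1) h(1)]] g(2) h(2) by simp
      qed
      then have "?a \<otimes> ?b = ?b \<otimes> ?a"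
        by (rule commute_twisted) (use far_comm in auto)
      moreover have "?a \<in> carrier G" "?b \<in> carrier G"
        using far_comm by auto
      ultimately show ?thesis using far_comm by simp
    qed
    then show ?case by (simp add: r)
  qed
qed

text \<open>
  The lemmas on twisting are stated for the crossings of \<open>VSB\<^sub>n\<close>, so they are applied to the
  twisted family \<open>\<mu>\<^sub>i v\<^sub>i\<close>, \<open>\<gamma>\<^sub>i v\<^sub>i\<close>; one more twist gives back \<open>\<mu>\<^sub>i\<close> and \<open>\<gamma>\<^sub>i\<close>.
\<close>

lemma represents_twist_m:
  assumes f: "represents G (m_gens n) (m_rels n) f"
  shows "represents G (vsb_gens n) (vsb_rels n) (twist_m G f)"
proof -
  have cl [simp]: "f (M_mu i) \<in> carrier G" "f (M_mu_inv i) \<in> carrier G"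
      "f (M_gamma i) \<in> carrier G" "f (M_v i) \<in> carrier G" if "i \<in> {1..n-1}" for i
    using that by (auto intro: represents_closed[OF f])
  have rel: "word_eval G f u = word_eval G f v" if "(u, v) \<in> m_rels n" for u v
    using f that by (rule represents_eq)
  have square: "f (M_v i) \<otimes> f (M_v i) = \<one>" if "i \<in> {1..n-1}" for i
    using rel[OF m_rels.v_square[OF that]] cl[OF that] by simp
  have braided: "braided_involutions G (f (M_v i)) (f (M_v j))"
    if "i \<in> {1..n-1}" "j \<in> {1..n-1}" "\<bar>int i - int j\<bar> = 1" for i j
    using rel[OF m_rels.v_braid[OF that]] cl[OF that(1)] cl[OF that(2)] square that(1,2)
    by unfold_locales auto
  have "braided_involutions.swapped G (f (M_v i)) (f (M_v j)) (f (M_mu i)) (f (M_mu j))"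
    "braided_involutions.swapped G (f (M_v i)) (f (M_v j)) (f (M_gamma i)) (f (M_gamma j))"
    if "i \<in> {1..n-1}" "j \<in> {1..n-1}" "\<bar>int i - int j\<bar> = 1" for i j
    using rel[OF m_rels.v_mu_v[OF that]] rel[OF m_rels.v_gamma_v[OF that]]
      cl[OF that(1)] cl[OF that(2)] braided[OF that]
    by (simp_all add: braided_involutions.swapped_def)
  then have swap_mu: "braided_involutions.swapped G (f (M_v i)) (f (M_v j))
        (f (M_mu i) \<otimes> f (M_v i)) (f (M_mu j) \<otimes> f (M_v j))"
    and swap_gamma: "braided_involutions.swapped G (f (M_v i)) (f (M_v j))
        (f (M_gamma i) \<otimes> f (M_v i)) (f (M_gamma j) \<otimes> f (M_v j))"
    if "i \<in> {1..n-1}" "j \<in> {1..n-1}" "\<bar>int i - int j\<bar> = 1" for i j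
    using braided_involutions.swapped_twist[OF braided[OF that]] that by auto
  have untwist: "(x \<otimes> f (M_v i)) \<otimes> f (M_v i) = x" if "i \<in> {1..n-1}" "x \<in> carrier G" for x i
    using that square by (simp add: m_assoc)
  show ?thesis
    unfolding represents_def
  proof (intro conjI ballI, goal_cases)
    case 1
    show ?case by (auto simp: vsb_gens_def)
  next
    case (2 r)
    then obtain u v where r: "r = (u, v)" "(u, v) \<in> vsb_rels n" by (cases r) auto
    from r(2) have "word_eval G (twist_m G f) u = word_eval G (twist_m G f) v"
    proof cases
      case (v_square i)
      then show ?thesis by (simp add: square)
    next
      case (sigma_inv_right i)
      then show ?thesis
        using rel[OF m_rels.mu_inv_right[of i]] rel[OF m_rels.mu_inv_left[of i]]
        by (simp add: inverse_twist square)
    next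
      case (sigma_inv_left i)
      then show ?thesis
        using rel[OF m_rels.mu_inv_right[of i]] rel[OF m_rels.mu_inv_left[of i]]
        by (simp add: inverse_twist square)
    next
      case (v_braid i j)
      then show ?thesis using rel[OF m_rels.v_braid[of i n j]] by simp
    next
      case (v_sigma_v i j)
      interpret braided_involutions G "f (M_v i)" "f (M_v j)"
        using braided v_sigma_v by simp
      show ?thesis
        using swap_mu[of i j] v_sigma_v by (simp add: swapped_def)
    next
      case (v_tau_v i j)
      interpret braided_involutions G "f (M_v i)" "f (M_v j)"
        using braided v_tau_v by simp
      show ?thesis
        using swap_gamma[of i j] v_tau_v by (simp add: swapped_def)
    next
      case (sigma_braid i j)
      interpret braided_involutions G "f (M_v i)" "f (M_v j)"
        using braided sigma_braid by simp
      show ?thesis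
        using triangle_relation_iff[OF swap_mu swap_mu] sigma_braid
          rel[OF m_rels.mu_mu_mu[of i n j]] by (simp add: untwist)
    next
      case (sigma_sigma_tau i j)
      \<comment> \<open>The relation of \<open>M\<^sub>n\<close> that matches has \<open>i\<close> and \<open>j\<close> interchanged.\<close>
      interpret braided_involutions G "f (M_v j)" "f (M_v i)"
        using braided sigma_sigma_tau by simp
      show ?thesis
        using triangle_relation_iff[OF swap_mu swap_gamma] sigma_sigma_tau
          rel[OF m_rels.mu_mu_gamma[of j n i]] by (simp add: untwist)
    next
      case (sigma_tau i)
      then show ?thesis
        using rel[OF m_rels.mu_v_gamma[of i n]]
          commute_twist_iff[of "f (M_v i)" "f (M_mu i) \<otimes> f (M_v i)" "f (M_gamma i) \<otimes> f (M_v i)"]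
        by (simp add: untwist square)
    next
      case (far_comm i j a b)
      let ?a = "twist_m G f a" and ?b = "twist_m G f b"
      have "x \<otimes> y = y \<otimes> x"
        if xy: "x \<in> {f (M_mu i), f (M_gamma i), f (M_v i)}"
          "y \<in> {f (M_mu j), f (M_gamma j), f (M_v j)}" for x y
      proof -
        obtain g h where g: "g \<in> {M_mu i, M_gamma i, M_v i}" "x = f g"
          and h: "h \<in> {M_mu j, M_gamma j, M_v j}" "y = f h"
          using xy by blast
        have "f g \<in> carrier G" "f h \<in> carrier G"
          using g(1) h(1) far_comm(3,4) by auto
        then show ?thesis
          using rel[OF m_rels.far_comm[OF far_comm(3-5) g(1) h(1)]] g(2) h(2) by simp
      qed
      then have "?a \<otimes> ?b = ?b \<otimes> ?a"
        by (rule commute_twisted) (use far_comm in auto)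
      moreover have "?a \<in> carrier G" "?b \<in> carrier G"
        using far_comm by auto
      ultimately show ?thesis using far_comm by simp
    qed
    then show ?case by (simp add: r)
  qed
qed

lemma twist_m_twist_vsb:
  assumes f: "represents G (vsb_gens n) (vsb_rels n) f" and b: "b \<in> vsb_gens n"
  shows "twist_m G (twist_vsb G f) b = f b"
proof -
  have cl: "f x \<in> carrier G" if "x \<in> vsb_gens n" for x
    using f that by (rule represents_closed)
  have square: "f (VSB_v i) \<otimes> f (VSB_v i) = \<one>" if "i \<in> {1..n-1}" for i
  proof -
    have "word_eval G f [VSB_v i, VSB_v i] = word_eval G f []"
      by (rule represents_eq[OF f vsb_rels.v_square[OF that]])
    then show ?thesis using cl[of "VSB_v i"] that by simp
  qed
  have "f (VSB_v i) \<otimes> (f (VSB_v i) \<otimes> x) = x" if "i \<in> {1..n-1}" "x \<in> carrier G" for x i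
    using that square cl[of "VSB_v i"] by (simp flip: m_assoc)
  then show ?thesis using b by (cases b) (simp_all add: m_assoc square cl)
qed

lemma twist_vsb_twist_m:
  assumes f: "represents G (m_gens n) (m_rels n) f" and a: "a \<in> m_gens n"
  shows "twist_vsb G (twist_m G f) a = f a"
proof -
  have cl: "f x \<in> carrier G" if "x \<in> m_gens n" for x
    using f that by (rule represents_closed)
  have square: "f (M_v i) \<otimes> f (M_v i) = \<one>" if "i \<in> {1..n-1}" for i
  proof -
    have "word_eval G f [M_v i, M_v i] = word_eval G f []"
      by (rule represents_eq[OF f m_rels.v_square[OF that]])
    then show ?thesis using cl[of "M_v i"] that by simp
  qed
  have "f (M_v i) \<otimes> (f (M_v i) \<otimes> x) = x" if "i \<in> {1..n-1}" "x \<in> carrier G" for x i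
    using that square cl[of "M_v i"] by (simp flip: m_assoc)
  then show ?thesis using a by (cases a) (simp_all add: m_assoc square cl)
qed

end

section \<open>The isomorphism\<close>

text \<open>
  Twisting is natural in the target monoid. This is what allows a composite of the two induced
  homomorphisms to be computed as an iterated twist of the tautological interpretation.
\<close>

lemma hom_twist_vsb:
  assumes "h \<in> hom G H" "f \<in> vsb_gens n \<rightarrow> carrier G" "a \<in> m_gens n"
  shows "h (twist_vsb G f a) = twist_vsb H (h \<circ> f) a"
  using assms by (cases a) (auto intro!: hom_mult[OF assms(1)] funcset_mem[OF assms(2)])

lemma hom_twist_m:
  assumes "h \<in> hom G H" "f \<in> m_gens n \<rightarrow> carrier G" "b \<in> vsb_gens n"
  shows "h (twist_m G f b) = twist_m H (h \<circ> f) b"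
  using assms by (cases b) (auto intro!: hom_mult[OF assms(1)] funcset_mem[OF assms(2)])

lemma twist_vsb_cong:
  assumes "\<And>b. b \<in> vsb_gens n \<Longrightarrow> f b = g b" "a \<in> m_gens n"
  shows "twist_vsb G f a = twist_vsb G g a"
  using assms by (cases a) auto

lemma twist_m_cong:
  assumes "\<And>a. a \<in> m_gens n \<Longrightarrow> f a = g a" "b \<in> vsb_gens n"
  shows "twist_m G f b = twist_m G g b"
  using assms by (cases b) auto

theorem theorem12:
  fixes n :: nat
  assumes "n \<ge> 2"
  shows "\<exists>h \<in> iso (M_monoid n) (VSB n). h \<one>\<^bsub>M_monoid n\<^esub> = \<one>\<^bsub>VSB n\<^esub>"
proof -
  interpret P: monoid "M_monoid n"
    unfolding M_monoid_def by (rule monoid_presented_monoid)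
  interpret Q: monoid "VSB n"
    unfolding VSB_def by (rule monoid_presented_monoid)
  define p where "p = (\<lambda>a. word_class (m_gens n) (m_rels n) [a])"
  define q where "q = (\<lambda>b. word_class (vsb_gens n) (vsb_rels n) [b])"
  have p: "represents (M_monoid n) (m_gens n) (m_rels n) p"
    unfolding p_def M_monoid_def by (rule represents_word_class[OF m_rels_words])
  have q: "represents (VSB n) (vsb_gens n) (vsb_rels n) q"
    unfolding q_def VSB_def by (rule represents_word_class[OF vsb_rels_words])
  let ?f = "twist_vsb (VSB n) q" and ?g = "twist_m (M_monoid n) p"
  let ?F = "induced_map (VSB n) ?f" and ?G = "induced_map (M_monoid n) ?g"
  note f = Q.represents_twist_vsb[OF q] and g = P.represents_twist_m[OF p]
  have F: "?F \<in> hom (M_monoid n) (VSB n)"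
    using Q.induced_map_hom[OF f] by (simp add: M_monoid_def)
  have G: "?G \<in> hom (VSB n) (M_monoid n)"
    using P.induced_map_hom[OF g] by (simp add: VSB_def)
  have Fp: "?F (p a) = ?f a" if "a \<in> m_gens n" for a
    unfolding p_def by (rule Q.induced_map_generator[OF f that])
  have Gq: "?G (q b) = ?g b" if "b \<in> vsb_gens n" for b
    unfolding q_def by (rule P.induced_map_generator[OF g that])
  have GF: "?G (?f a) = p a" if a: "a \<in> m_gens n" for a
  proof -
    have "?G (?f a) = twist_vsb (M_monoid n) (?G \<circ> q) a"
      by (rule hom_twist_vsb[OF G represents_funcset[OF q] a])
    also have "\<dots> = twist_vsb (M_monoid n) ?g a"
      by (rule twist_vsb_cong[OF _ a]) (simp add: Gq)
    also have "\<dots> = p a"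
      by (rule P.twist_vsb_twist_m[OF p a])
    finally show ?thesis .
  qed
  have FG: "?F (?g b) = q b" if b: "b \<in> vsb_gens n" for b
  proof -
    have "?F (?g b) = twist_m (VSB n) (?F \<circ> p) b"
      by (rule hom_twist_m[OF F represents_funcset[OF p] b])
    also have "\<dots> = twist_m (VSB n) ?f b"
      by (rule twist_m_cong[OF _ b]) (simp add: Fp)
    also have "\<dots> = q b"
      by (rule Q.twist_m_twist_vsb[OF q b])
    finally show ?thesis .
  qed
  have "?F \<in> iso (M_monoid n) (VSB n)"
    using presented_monoid_iso[of "vsb_gens n" "vsb_rels n" "m_gens n" "m_rels n" ?f ?g]
      f g GF FG
    by (simp add: M_monoid_def VSB_def p_def q_def)
  moreover have "?F \<one>\<^bsub>M_monoid n\<^esub> = \<one>\<^bsub>VSB n\<^esub>"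
    using Q.induced_map_one[OF f] by (simp add: M_monoid_def)
  ultimately show ?thesis by blast
qed

end
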